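(* For matrices $A\in\mathbb R^{r\times n}$, $B\in\mathbb R^{r\times m}$, $D\in\mathbb R^{q\times m}$ and a vector $d\in\mathbb R^r$, let $f(x,y):=Dy$ and $\Gamma(x):=\{y\in\mathbb R^m\mid Ax+By\leq d\}$ for all $x\in\mathbb R^n$, $y\in\mathbb R^m$, and fix $\mathcal C:=\mathbb R^q_+$. Then the following assertions hold. (a) Let $\operatorname{gph}\Psi\cap(X\times\mathbb R^m)$ be nonempty and bounded. Then there exist an efficient and a weakly efficient point of $\min_{x,y}{}_{\mathcal K}\{F(x,y)\mid x\in X,\ y\in\Psi(x)\}$. (b) Let $\operatorname{gph}\Psi_{\mathrm w}\cap(X\times\mathbb R^m)$ be nonempty and bounded. Then there exist an efficient and a weakly efficient point of $\min_{x,y}{}_{\mathcal K}\{F(x,y)\mid x\in X,\ y\in\Psi_{\mathrm w}(x)\}$.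
   Context: Setting: $F\colon\mathbb R^n\times\mathbb R^m\to\mathbb R^p$ is continuous, $\mathcal K\subset\mathbb R^p$ is a nonempty, closed, convex, pointed cone with nonempty interior, and $X\subset\mathbb R^n$ is nonempty and closed. For $x\in\mathbb R^n$, with $f(x,A'):=\{f(x,y)\mid y\in A'\}$ for $A'\subset\mathbb R^m$, $\Psi(x):=\{y\in\Gamma(x)\mid (\{f(x,y)\}-\mathcal C\setminus\{0\})\cap f(x,\Gamma(x))=\emptyset\}$ and $\Psi_{\mathrm w}(x):=\{y\in\Gamma(x)\mid (\{f(x,y)\}-\operatorname{int}\mathcal C)\cap f(x,\Gamma(x))=\emptyset\}$. The graph of a set-valued mapping $\Upsilon$ is $\operatorname{gph}\Upsilon:=\{(x,y)\mid y\in\Upsilon(x)\}$. For a problem $\min_{\mathcal K}\{F(x,y)\mid (x,y)\in S\}$, a point $(\bar x,\bar y)\in S$ is efficient if $(\{F(\bar x,\bar y)\}-\mathcal K\setminus\{0\})\cap F(S)=\emptyset$, and weakly efficient if $(\{F(\bar x,\bar y)\}-\operatorname{int}\mathcal K)\cap F(S)=\emptyset$. *)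

theory Defs
  imports "HOL-Analysis.Analysis"
begin

definition efficient :: "'b::euclidean_space set \<Rightarrow> ('a \<Rightarrow> 'b) \<Rightarrow> 'a set \<Rightarrow> 'a \<Rightarrow> bool" where
  "efficient K g S z \<longleftrightarrow> z \<in> S \<and> (\<lambda>k. g z - k) ` (K - {0}) \<inter> g ` S = {}"

definition weakly_efficient :: "'b::euclidean_space set \<Rightarrow> ('a \<Rightarrow> 'b) \<Rightarrow> 'a set \<Rightarrow> 'a \<Rightarrow> bool" where
  "weakly_efficient K g S z \<longleftrightarrow> z \<in> S \<and> (\<lambda>k. g z - k) ` interior K \<inter> g ` S = {}"

definition Psi :: "'c::euclidean_space set \<Rightarrow> ('a \<Rightarrow> 'b \<Rightarrow> 'c) \<Rightarrow> ('a \<Rightarrow> 'b set) \<Rightarrow> 'a \<Rightarrow> 'b set" where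
  "Psi C f \<Gamma> x = {y. efficient C (f x) (\<Gamma> x) y}"

definition Psi_w :: "'c::euclidean_space set \<Rightarrow> ('a \<Rightarrow> 'b \<Rightarrow> 'c) \<Rightarrow> ('a \<Rightarrow> 'b set) \<Rightarrow> 'a \<Rightarrow> 'b set" where
  "Psi_w C f \<Gamma> x = {y. weakly_efficient C (f x) (\<Gamma> x) y}"

definition gph :: "('a \<Rightarrow> 'b set) \<Rightarrow> ('a \<times> 'b) set" where
  "gph \<Upsilon> = {(x, y). y \<in> \<Upsilon> x}"

definition pointed :: "'a::real_vector set \<Rightarrow> bool" where
  "pointed K \<longleftrightarrow> K \<inter> uminus ` K = {0}"

text \<open>The order on \<^typ>\<open>real ^ 'q\<close> is componentwise, so this is the nonnegative orthant.\<close>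

definition nonneg_orthant :: "(real ^ 'q) set" where
  "nonneg_orthant = {z. 0 \<le> z}"

end

theory Submission
  imports Defs
begin

text \<open>Efficiency (or weak efficiency) of a feasible point of the lower-level linear program only
  depends on which constraints are active there, and it persists when more constraints become
  active. Limits only activate further constraints, so the graphs of both solution mappings are
  closed, hence compact once bounded over \<open>X\<close>. A closed convex pointed cone \<open>K\<close> admits a linear
  functional that is positive on \<open>K - {0}\<close>, and any minimizer of its composition with \<open>F\<close> is
  efficient.\<close>

text \<open>If a convex combination of two nonzero points of \<open>K\<close> vanished,
  \<open>u *\<^sub>R x\<close> would lie in \<open>K\<close> together with its negative, so
  pointedness would force both summands to be zero, although \<open>u\<close> and \<open>v\<close>
  are not both zero.\<close>

lemma pointed_cone_convex_minus_0:
  fixes K :: "'a::real_vector set"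
  assumes "convex K" "cone K" "pointed K"
  shows "convex (K - {0})"
proof (rule convexI)
  fix x y :: 'a and u v :: real
  assume xy: "x \<in> K - {0}" "y \<in> K - {0}" and uv: "0 \<le> u" "0 \<le> v" "u + v = 1"
  have mem: "u *\<^sub>R x \<in> K" "v *\<^sub>R y \<in> K"
    using assms(2) xy uv by (auto simp: cone_def)
  have "u *\<^sub>R x + v *\<^sub>R y \<noteq> 0"
  proof
    assume "u *\<^sub>R x + v *\<^sub>R y = 0"
    then have eq: "u *\<^sub>R x = - (v *\<^sub>R y)"
      by (simp add: eq_neg_iff_add_eq_0)
    then have "u *\<^sub>R x \<in> K \<inter> uminus ` K"
      using mem by auto
    then have "u *\<^sub>R x = 0"
      using assms(3) unfolding pointed_def by blast
    then show False
      using eq xy uv by auto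
  qed
  moreover have "u *\<^sub>R x + v *\<^sub>R y \<in> K"
    using assms(1) xy uv by (auto intro: convexD)
  ultimately show "u *\<^sub>R x + v *\<^sub>R y \<in> K - {0}"
    by simp
qed

text \<open>Strictly separate 0 from the convex hull of the unit vectors of \<open>K\<close>, then
  extend positivity to all of \<open>K - {0}\<close> by scaling. The hull is compact, and it misses
  0 because \<open>K - {0}\<close> is itself convex.\<close>

lemma pointed_cone_positive_functional:
  fixes K :: "'a::euclidean_space set"
  assumes "closed K" "convex K" "cone K" "pointed K"
  obtains w where "\<And>k. k \<in> K - {0} \<Longrightarrow> 0 < w \<bullet> k"
proof -
  let ?H = "convex hull (K \<inter> sphere 0 1)"
  have "?H \<subseteq> K - {0}"
    by (rule hull_minimal) (use pointed_cone_convex_minus_0[OF assms(2-4)] in auto)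
  moreover have "closed ?H"
    by (intro compact_imp_closed compact_convex_hull assms(1) closed_Int_compact compact_sphere)
  ultimately obtain w b where w: "0 < b" "\<And>x. x \<in> ?H \<Longrightarrow> b < w \<bullet> x"
    using separating_hyperplane_closed_0[OF convex_convex_hull] by blast
  have "0 < w \<bullet> k" if k: "k \<in> K - {0}" for k
  proof -
    have "(1 / norm k) *\<^sub>R k \<in> K \<inter> sphere 0 1"
      using assms(3) k by (auto simp: cone_def)
    then have "0 < w \<bullet> ((1 / norm k) *\<^sub>R k)"
      using w by (meson hull_inc less_trans)
    then show ?thesis
      using k by (simp add: zero_less_divide_iff)
  qed
  then show thesis
    using that by blast
qed

text \<open>A ball around 0 contains a nonzero vector along with its negative. This is what makes
  efficiency the stronger notion: \<open>interior K\<close> lies inside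
  \<open>K - {0}\<close>.\<close>

lemma pointed_cone_0_notin_interior:
  fixes K :: "'a::euclidean_space set"
  assumes "pointed K"
  shows "0 \<notin> interior K"
proof
  assume "0 \<in> interior K"
  then obtain e where e: "0 < e" "ball 0 e \<subseteq> K"
    by (auto simp: mem_interior)
  obtain b :: 'a where b: "b \<in> Basis"
    using nonempty_Basis by blast
  define v where "v = (e / 2) *\<^sub>R b"
  have "v \<in> K" "- v \<in> K" "v \<noteq> 0"
    using e b by (auto simp: v_def subset_iff)
  then have "v \<in> K \<inter> uminus ` K"
    by (metis IntI image_eqI minus_minus)
  then show False
    using assms \<open>v \<noteq> 0\<close> unfolding pointed_def by blast
qed

lemma efficient_imp_weakly_efficient:
  assumes "pointed K" "efficient K g S z"
  shows "weakly_efficient K g S z"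
proof -
  have "interior K \<subseteq> K - {0}"
    using pointed_cone_0_notin_interior[OF assms(1)] interior_subset by blast
  then show ?thesis
    using assms(2) unfolding efficient_def weakly_efficient_def by blast
qed

lemma efficient_point_exists:
  fixes g :: "'a::topological_space \<Rightarrow> 'b::euclidean_space"
  assumes "compact S" "S \<noteq> {}" "continuous_on S g"
    and "closed K" "convex K" "cone K" "pointed K"
  obtains z where "efficient K g S z"
proof -
  obtain w where w: "\<And>k. k \<in> K - {0} \<Longrightarrow> 0 < w \<bullet> k"
    using pointed_cone_positive_functional[OF assms(4-7)] by blast
  obtain z where z: "z \<in> S" "\<And>y. y \<in> S \<Longrightarrow> w \<bullet> g z \<le> w \<bullet> g y"
    using continuous_attains_inf[OF assms(1,2) continuous_on_inner[OF continuous_on_const assms(3)]]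
    by blast
  have "g y \<noteq> g z - k" if "y \<in> S" "k \<in> K - {0}" for y k
  proof
    assume "g y = g z - k"
    then show False
      using z(2)[OF that(1)] w[OF that(2)] by (simp add: inner_diff_right)
  qed
  then have "efficient K g S z"
    using z(1) by (force simp: efficient_def)
  then show thesis
    using that by blast
qed

text \<open>The set \<open>P\<close> of improving differences is left abstract so that
  \<open>C - {0}\<close> and \<open>interior C\<close> are treated at once. If some
  \<open>y'\<close> dominated a limit point, half of the step towards \<open>y'\<close> would be
  feasible at a nearby point of the graph and would dominate that point too, since \<open>P\<close>
  is stable under halving.\<close>

lemma closed_gph_linear_program:
  fixes A :: "real ^ 'n ^ 'r" and B :: "real ^ 'm ^ 'r" and D :: "real ^ 'm ^ 'q"
  assumes half: "\<And>p. p \<in> P \<Longrightarrow> (1 / 2) *\<^sub>R p \<in> P"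
    and \<Gamma>: "\<And>x. \<Gamma> x = {y. A *v x + B *v y \<le> d}"
  shows "closed {(x, y). y \<in> \<Gamma> x \<and> (\<forall>y'\<in>\<Gamma> x. D *v y - D *v y' \<notin> P)}" (is "closed ?G")
proof -
  define h where "h i = (\<lambda>(x, y). (A *v x + B *v y) $ i)" for i
  have cont: "continuous_on S (h i)" for i S
    unfolding h_def case_prod_beta
    by (intro continuous_intros bounded_linear.continuous_on[OF matrix_vector_mul_bounded_linear])
  have feas: "y \<in> \<Gamma> x \<longleftrightarrow> (\<forall>i. h i (x, y) \<le> d $ i)" for x y
    by (simp add: \<Gamma> h_def less_eq_vec_def)
  \<comment> \<open>Each \<open>h i\<close> is linear, so its increment along \<open>v\<close> is
    the same at every base point. Slopes found at the limit \<open>(x0, y0)\<close> thus carry over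
    to nearby points \<open>(x, y)\<close>.\<close>
  have h_step: "h i (x, y + t *\<^sub>R v) = h i (x, y) + t * (h i (x', y' + v) - h i (x', y'))"
    for i x y t v x' y'
    by (simp add: h_def algebra_simps)
  have "(x0, y0) \<in> ?G" if cl: "(x0, y0) \<in> closure ?G" for x0 y0
  proof -
    have "closed {z. \<forall>i. h i z \<le> d $ i}"
      by (intro closed_Collect_all closed_Collect_le cont continuous_on_const)
    then have "closure ?G \<subseteq> {z. \<forall>i. h i z \<le> d $ i}"
      by (intro closure_minimal) (auto simp: feas)
    then have y0: "y0 \<in> \<Gamma> x0"
      using cl by (auto simp: feas)
    moreover have "D *v y0 - D *v y' \<notin> P" if y': "y' \<in> \<Gamma> x0" for y'
    proof
      assume dom: "D *v y0 - D *v y' \<in> P"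
      define v where "v = y' - y0"
      \<comment> \<open>Half a step keeps the inactive constraints strictly inactive, which is an open condition;
        the active ones are nonincreasing along \<open>v\<close>.\<close>
      define U where "U = {z. \<forall>i. h i (x0, y0) < d $ i \<longrightarrow> h i (fst z, snd z + (1/2) *\<^sub>R v) < d $ i}"
      \<comment> \<open>\<open>Q\<close> stands for inactivity at \<open>(x0, y0)\<close>, which
        does not depend on \<open>z\<close>. Hence \<open>U\<close> is a finite intersection of open
        sets.\<close>
      have "open {z. Q \<longrightarrow> h i (fst z, snd z + (1/2) *\<^sub>R v) < d $ i}" for Q i
        by (intro open_Collect_imp open_Collect_less continuous_on_const
            continuous_on_compose2[OF cont[of UNIV]] continuous_intros) auto
      then have "open U"
        unfolding U_def by (simp add: Collect_all_eq open_INT)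
      moreover have "(x0, y0) \<in> U"
      proof -
        have "h i (x0, y0 + (1/2) *\<^sub>R v) < d $ i" if "h i (x0, y0) < d $ i" for i
        proof -
          have "h i (x0, y0 + v) \<le> d $ i"
            using y' by (simp add: feas v_def)
          then show ?thesis
            \<comment> \<open>The value at the half step is the mean of one number below
              \<open>d $ i\<close> and one at most \<open>d $ i\<close>.\<close>
            using that h_step[of i x0 y0 "1/2" v x0 y0] by (simp add: field_simps)
        qed
        then show ?thesis
          by (simp add: U_def)
      qed
      ultimately obtain z where z: "z \<in> ?G" "z \<in> U"
        using cl by (meson closure_iff_nhds_not_empty disjoint_iff order_refl)
      obtain x y where xy: "z = (x, y)"
        by (cases z)
      have "h i (x, y + (1/2) *\<^sub>R v) \<le> d $ i" for i
      proof (cases "h i (x0, y0) < d $ i")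
        case True
        then show ?thesis
          using z xy by (auto simp: U_def less_imp_le)
      next
        case False
        then have "h i (x0, y0 + v) \<le> h i (x0, y0)"
          using y' by (auto simp: feas v_def intro: order_trans)
        moreover have "h i (x, y) \<le> d $ i"
          using z xy by (auto simp: feas)
        ultimately show ?thesis
          using h_step[of i x y "1/2" v x0 y0] by (simp add: field_simps)
      qed
      then have "y + (1/2) *\<^sub>R v \<in> \<Gamma> x"
        by (simp add: feas)
      \<comment> \<open>The objective is linear and independent of \<open>x\<close>, so the gain at
        \<open>(x, y)\<close> is half the gain at the limit.\<close>
      moreover have "D *v y - D *v (y + (1/2) *\<^sub>R v) = (1/2) *\<^sub>R (D *v y0 - D *v y')"
        by (simp add: v_def algebra_simps)
      ultimately show False
        using z xy half[OF dom] by auto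
    qed
    ultimately show ?thesis
      by simp
  qed
  then have "closure ?G \<subseteq> ?G"
    by (rule subrelI)
  then show ?thesis
    by (simp only: closure_subset_eq)
qed

lemma nonneg_orthant_minus_0_half:
  "p \<in> nonneg_orthant - {0} \<Longrightarrow> (1 / 2) *\<^sub>R p \<in> nonneg_orthant - {0}"
  by (auto simp: nonneg_orthant_def less_eq_vec_def)

text \<open>Scaling by 1/2 is an open map that keeps the orthant inside itself, so the image of the
  interior is an open subset of the orthant.\<close>

lemma interior_nonneg_orthant_half:
  assumes "p \<in> interior nonneg_orthant"
  shows "(1 / 2) *\<^sub>R p \<in> interior nonneg_orthant"
proof (rule interiorI)
  show "open ((*\<^sub>R) (1 / 2) ` interior nonneg_orthant)"
    by (rule open_scaling) auto
  show "(1 / 2) *\<^sub>R p \<in> (*\<^sub>R) (1 / 2) ` interior nonneg_orthant"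
    using assms by blast
  show "(*\<^sub>R) (1 / 2) ` interior nonneg_orthant \<subseteq> nonneg_orthant"
    using interior_subset by (fastforce simp: nonneg_orthant_def less_eq_vec_def)
qed

theorem corollary3p16:
  fixes F :: "(real ^ 'n) \<times> (real ^ 'm) \<Rightarrow> real ^ 'p"
    and K :: "(real ^ 'p) set"
    and X :: "(real ^ 'n) set"
    and A :: "real ^ 'n ^ 'r"
    and B :: "real ^ 'm ^ 'r"
    and D :: "real ^ 'm ^ 'q"
    and d :: "real ^ 'r"
    and f :: "real ^ 'n \<Rightarrow> real ^ 'm \<Rightarrow> real ^ 'q"
    and \<Gamma> :: "real ^ 'n \<Rightarrow> (real ^ 'm) set"
    and C :: "(real ^ 'q) set"
  assumes "continuous_on UNIV F"
    and "K \<noteq> {}" "closed K" "convex K" "cone K" "pointed K" "interior K \<noteq> {}"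
    and "X \<noteq> {}" "closed X"
    and "\<And>x y. f x y = D *v y"
    and "\<And>x. \<Gamma> x = {y. A *v x + B *v y \<le> d}"
    and "C = nonneg_orthant"
  shows "(gph (Psi C f \<Gamma>) \<inter> (X \<times> UNIV) \<noteq> {} \<and> bounded (gph (Psi C f \<Gamma>) \<inter> (X \<times> UNIV)) \<longrightarrow>
           (\<exists>z. efficient K F {(x, y). x \<in> X \<and> y \<in> Psi C f \<Gamma> x} z) \<and>
           (\<exists>z. weakly_efficient K F {(x, y). x \<in> X \<and> y \<in> Psi C f \<Gamma> x} z))
       \<and> (gph (Psi_w C f \<Gamma>) \<inter> (X \<times> UNIV) \<noteq> {} \<and> bounded (gph (Psi_w C f \<Gamma>) \<inter> (X \<times> UNIV)) \<longrightarrow>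
           (\<exists>z. efficient K F {(x, y). x \<in> X \<and> y \<in> Psi_w C f \<Gamma> x} z) \<and>
           (\<exists>z. weakly_efficient K F {(x, y). x \<in> X \<and> y \<in> Psi_w C f \<Gamma> x} z))"
proof -
  \<comment> \<open>Both assertions reduce to this claim about a mapping with closed graph, leaving
    only the closedness of the two graphs to check.\<close>
  have exists: "(\<exists>z. efficient K F {(x, y). x \<in> X \<and> y \<in> \<Upsilon> x} z) \<and>
      (\<exists>z. weakly_efficient K F {(x, y). x \<in> X \<and> y \<in> \<Upsilon> x} z)"
    if cl: "closed (gph \<Upsilon>)" and ne: "gph \<Upsilon> \<inter> (X \<times> UNIV) \<noteq> {}"
      and bd: "bounded (gph \<Upsilon> \<inter> (X \<times> UNIV))"
    for \<Upsilon> :: "real ^ 'n \<Rightarrow> (real ^ 'm) set"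
  proof -
    have eq: "{(x, y). x \<in> X \<and> y \<in> \<Upsilon> x} = gph \<Upsilon> \<inter> (X \<times> UNIV)"
      by (auto simp: gph_def)
    have "compact (gph \<Upsilon> \<inter> (X \<times> UNIV))"
      using cl bd assms(9) by (simp add: compact_eq_bounded_closed closed_Int closed_Times)
    then obtain z where "efficient K F {(x, y). x \<in> X \<and> y \<in> \<Upsilon> x} z"
      unfolding eq
      using efficient_point_exists[OF _ ne continuous_on_subset[OF assms(1) subset_UNIV] assms(3-6)]
      by blast
    then show ?thesis
      using efficient_imp_weakly_efficient[OF assms(6), of F _ z] by (intro conjI exI[of _ z])
  qed
  \<comment> \<open>This turns the image-based definitions of efficiency into the difference form
    used in \<open>closed_gph_linear_program\<close>.\<close>
  have disj: "(\<lambda>k. D *v y - k) ` P \<inter> (*v) D ` S = {} \<longleftrightarrow> (\<forall>y'\<in>S. D *v y - D *v y' \<notin> P)"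
    for y P S
  proof -
    have "D *v y - k = D *v y' \<longleftrightarrow> k = D *v y - D *v y'" for y' k
      by (auto simp: algebra_simps)
    then show ?thesis
      by (auto simp: disjoint_iff image_iff)
  qed
  have f_eq: "f = (\<lambda>x y. D *v y)"
    using assms(10) by blast
  have "gph (Psi C f \<Gamma>) = {(x, y). y \<in> \<Gamma> x \<and> (\<forall>y'\<in>\<Gamma> x. D *v y - D *v y' \<notin> C - {0})}"
    unfolding gph_def Psi_def efficient_def f_eq disj by simp
  then have "closed (gph (Psi C f \<Gamma>))"
    using closed_gph_linear_program[OF nonneg_orthant_minus_0_half assms(11)] assms(12) by simp
  moreover have "gph (Psi_w C f \<Gamma>) = {(x, y). y \<in> \<Gamma> x \<and> (\<forall>y'\<in>\<Gamma> x. D *v y - D *v y' \<notin> interior C)}"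
    unfolding gph_def Psi_w_def weakly_efficient_def f_eq disj by simp
  then have "closed (gph (Psi_w C f \<Gamma>))"
    using closed_gph_linear_program[OF interior_nonneg_orthant_half assms(11)] assms(12) by simp
  ultimately show ?thesis
    using exists by blast
qed

end
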